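(* Let $\mathcal{A}$ be a finite-dimensional descendingly alternative algebra over an arbitrary field $\mathbb{F}$ with $\dim \mathcal{A} - d_0 \geq 3$. Then $l(\mathcal{A}) \leq \lceil \log_2(\dim \mathcal{A} - d_0) \rceil$.
   Context: $\mathcal{A}$ is a finite-dimensional algebra over a field $\mathbb{F}$ (a vector space with a bilinear product), possibly non-unital and non-associative. If $\mathcal{A}$ is unital, its unity is denoted by $e$. For $S \subseteq \mathcal{A}$ and $k\ge 1$, a word of length $k$ in $S$ is any product of $k$ elements of $S$, with any arrangement of brackets. If $\mathcal{A}$ is unital, $e$ is a word of length $0$; otherwise there are no words of length $0$. $S^k$ is the set of all words in $S$ of length at most $k$. $\mathcal{L}(X)$ denotes the linear span of $X$, $\mathcal{L}_k(S) = \mathcal{L}(S^k)$ for $k\ge 0$, and $\mathcal{L}_\infty(S) = \bigcup_{k\ge 0}\mathcal{L}_k(S)$. $S$ is generating for $\mathcal{A}$ if $\mathcal{L}_\infty(S)=\mathcal{A}$. The length of $S$ is $l(S) = \min\{k : \mathcal{L}_k(S)=\mathcal{L}_\infty(S)\}$, and the length of $\mathcal{A}$ is $l(\mathcal{A}) = \max\{l(S) : \mathcal{L}_\infty(S)=\mathcal{A}\}$. Set $d_0 = 1$ if $\mathcal{A}$ is unital, and $d_0 = 0$ otherwise. For $a,b,c\in\mathcal{A}$ let $\mathcal{L}'_2(a,b,c)$ be the span of $a,b,c,ab,ba,cb,bc,ac,ca$ (together with $e$ if $\mathcal{A}$ is unital), and let $\mathcal{L}_1(a,b,aa,ab,ba)$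 be the span of $a,b,aa,ab,ba$ (together with $e$ if $\mathcal{A}$ is unital). $\mathcal{A}$ is descendingly alternative if for all $a,b,c\in\mathcal{A}$: $(ba)a,\ a(ab) \in \mathcal{L}_1(a,b,aa,ab,ba)$; $(ab)c+(ac)b\in\mathcal{L}'_2(a,b,c)$; and $a(bc)+b(ac)\in\mathcal{L}'_2(a,b,c)$. *)

theory Defs
  imports Complex_Main
begin

text \<open>The algebra is the whole type \<open>'a\<close>. Neither associativity, commutativity nor a unity is
  assumed of \<open>mult\<close>.\<close>

locale nonassoc_algebra = vector_space scale
  for scale :: "'f::field \<Rightarrow> 'a::ab_group_add \<Rightarrow> 'a" +
  fixes mult :: "'a \<Rightarrow> 'a \<Rightarrow> 'a"
  assumes linear_mult_left: "Vector_Spaces.linear scale scale (\<lambda>x. mult x y)"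
    and linear_mult_right: "Vector_Spaces.linear scale scale (\<lambda>y. mult x y)"
begin

definition finite_dim :: bool where
  "finite_dim \<longleftrightarrow> (\<exists>B. finite B \<and> span B = UNIV)"

definition is_unity :: "'a \<Rightarrow> bool" where
  "is_unity e \<longleftrightarrow> (\<forall>x. mult e x = x \<and> mult x e = x)"

definition unital :: bool where
  "unital \<longleftrightarrow> (\<exists>e. is_unity e)"

definition d0 :: nat where
  "d0 = (if unital then 1 else 0)"

text \<open>\<open>word S k w\<close>: the element \<open>w\<close> is the value of some bracketed product of \<open>k\<close> elements of \<open>S\<close>.
  Products are formed from factors of positive length only; the unity, if there is one,
  is the only word of length 0.\<close>

inductive word :: "'a set \<Rightarrow> nat \<Rightarrow> 'a \<Rightarrow> bool" for S :: "'a set" where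
  unity: "is_unity e \<Longrightarrow> word S 0 e"
| gen: "s \<in> S \<Longrightarrow> word S 1 s"
| prod: "word S i u \<Longrightarrow> word S j v \<Longrightarrow> i \<ge> 1 \<Longrightarrow> j \<ge> 1 \<Longrightarrow> word S (i + j) (mult u v)"

definition words_upto :: "'a set \<Rightarrow> nat \<Rightarrow> 'a set" where
  "words_upto S k = {w. \<exists>j\<le>k. word S j w}"

definition lin :: "'a set \<Rightarrow> nat \<Rightarrow> 'a set" where
  "lin S k = span (words_upto S k)"

definition lin_inf :: "'a set \<Rightarrow> 'a set" where
  "lin_inf S = (\<Union>k. lin S k)"

definition generating :: "'a set \<Rightarrow> bool" where
  "generating S \<longleftrightarrow> lin_inf S = UNIV"

definition set_length :: "'a set \<Rightarrow> nat" where
  "set_length S = (LEAST k. lin S k = lin_inf S)"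

text \<open>In finite dimension the lengths of generating sets are bounded, and \<open>UNIV\<close> is
  generating, so \<open>Max\<close> is taken over a finite nonempty set.\<close>

definition alg_length :: nat where
  "alg_length = Max {set_length S | S. generating S}"

text \<open>The set \<open>{e. is_unity e}\<close> is \<open>{e}\<close> if the algebra is unital with unity \<open>e\<close>, and empty
  otherwise.\<close>

definition L2' :: "'a \<Rightarrow> 'a \<Rightarrow> 'a \<Rightarrow> 'a set" where
  "L2' a b c = span ({a, b, c, mult a b, mult b a, mult c b, mult b c, mult a c, mult c a}
     \<union> {e. is_unity e})"

definition L1 :: "'a \<Rightarrow> 'a \<Rightarrow> 'a set" where
  "L1 a b = span ({a, b, mult a a, mult a b, mult b a} \<union> {e. is_unity e})"

definition descendingly_alternative :: bool where
  "descendingly_alternative \<longleftrightarrow> (\<forall>a b c.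
     mult (mult b a) a \<in> L1 a b \<and>
     mult a (mult a b) \<in> L1 a b \<and>
     mult (mult a b) c + mult (mult a c) b \<in> L2' a b c \<and>
     mult a (mult b c) + mult b (mult a c) \<in> L2' a b c)"

end

end

theory Submission
  imports Defs "HOL-Library.Multiset"
begin

text \<open>Filter the algebra by \<open>F n = lin S n\<close>. Descending alternativity says that modulo lower terms
  left multiplications by elements of positive degree anticommute and square to zero, and so do
  right multiplications; on products, moreover, left and right multiplications by letters commute.
  Hence modulo lower terms every word of length \<open>k \<ge> 2\<close> is, up to sign, a product of left
  multiplications by letters \<open>x\<^sub>2, \<dots>, x\<^sub>p\<close> and right multiplications by letters
  \<open>y\<^sub>2, \<dots>, y\<^sub>q\<close> applied to \<open>x\<^sub>1 y\<^sub>1\<close>, with \<open>p + q = k\<close>, and it alternates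
  in the \<open>x\<^sub>i\<close> and in the \<open>y\<^sub>j\<close> separately. If it is nonzero, the subwords on nonempty
  subsets \<open>I\<close> of the \<open>x\<^sub>i\<close> and \<open>J\<close> of the \<open>y\<^sub>j\<close> are independent modulo \<open>F 0\<close>, since
  multiplying by the complementary letters recovers the word from \<open>(I, J)\<close> but kills every other
  subword of the same length. Together with the letters \<open>y\<^sub>j\<close> (or \<open>x\<^sub>i\<close> if \<open>q = 1\<close>) there are
  \<open>(2\<^sup>p - 1)(2\<^sup>q - 1) + q\<close> (or \<open>2\<^sup>p - 1 + p\<close>) of them, at least \<open>2\<^sup>k\<^sup>-\<^sup>1 + 1\<close>
  when \<open>k \<ge> 3\<close>. The hypothesis \<open>dim - d0 \<ge> 3\<close> covers \<open>k \<le> 2\<close>.\<close>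

context nonassoc_algebra
begin

section \<open>Bilinearity and the filtration \<open>lin S n\<close>\<close>

lemma mult_add_left: "mult (x + y) z = mult x z + mult y z"
proof -
  interpret l: Vector_Spaces.linear scale scale "\<lambda>x. mult x z" by (rule linear_mult_left)
  show ?thesis by (rule l.add)
qed

lemma mult_add_right: "mult z (x + y) = mult z x + mult z y"
proof -
  interpret l: Vector_Spaces.linear scale scale "\<lambda>x. mult z x" by (rule linear_mult_right)
  show ?thesis by (rule l.add)
qed

lemma linear_comp:
  assumes "Vector_Spaces.linear scale scale f" "Vector_Spaces.linear scale scale g"
  shows "Vector_Spaces.linear scale scale (\<lambda>x. f (g x))"
  using Vector_Spaces.linear_compose[OF assms(2,1)] by (simp add: o_def)

lemma linear_foldr:
  assumes "\<And>a. Vector_Spaces.linear scale scale (f a)"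
  shows "Vector_Spaces.linear scale scale (foldr f xs)"
proof (induction xs)
  case Nil
  show ?case using linear_id by (simp add: id_def[symmetric] foldr.simps)
next
  case (Cons a xs)
  have "foldr f (a # xs) = f a \<circ> foldr f xs" by auto
  then show ?case using Vector_Spaces.linear_compose[OF Cons assms] by metis
qed

lemma subspace_lin: "subspace (lin S n)"
  unfolding lin_def by (rule subspace_span)

lemmas lin_add = subspace_add[OF subspace_lin]
lemmas lin_diff = subspace_diff[OF subspace_lin]
lemmas lin_neg = subspace_neg[OF subspace_lin]
lemmas lin_scale = subspace_scale[OF subspace_lin]
lemmas lin_zero = subspace_0[OF subspace_lin]
lemmas lin_sum = subspace_sum[OF subspace_lin]

lemma lin_mono: "m \<le> n \<Longrightarrow> lin S m \<subseteq> lin S n"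
  unfolding lin_def words_upto_def by (rule span_mono) (auto intro: le_trans)

lemma lin_monoD: "x \<in> lin S m \<Longrightarrow> m \<le> n \<Longrightarrow> x \<in> lin S n"
  using lin_mono by blast

lemma word_in_lin: "word S n w \<Longrightarrow> w \<in> lin S n"
  unfolding lin_def words_upto_def by (rule span_base) auto

lemma gen_in_lin: "s \<in> S \<Longrightarrow> s \<in> lin S 1"
  by (intro word_in_lin word.gen)

lemma unity_in_lin: "is_unity e \<Longrightarrow> e \<in> lin S n"
  using word_in_lin[OF word.unity] lin_monoD by blast

lemma word_0: "word S 0 w \<Longrightarrow> is_unity w"
  by (cases rule: word.cases) auto

text \<open>A factor of length 0 is the unity and drops out, so the restriction to positive lengths
  in \<open>word.prod\<close> costs nothing.\<close>

lemma word_mult: "word S i u \<Longrightarrow> word S j v \<Longrightarrow> word S (i + j) (mult u v)"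
  using word_0[of S u] word_0[of S v] word.prod[of S i u j v]
  by (cases "i = 0"; cases "j = 0") (auto simp: is_unity_def)

text \<open>By linearity it is enough to treat words: the right argument is expanded first, for a
  fixed word on the left, and then the left one.\<close>

lemma lin_mult:
  assumes "u \<in> lin S i" "v \<in> lin S j"
  shows "mult u v \<in> lin S (i + j)"
proof -
  have 1: "mult u v \<in> lin S (i + j)" if u: "u \<in> words_upto S i" and v: "v \<in> lin S j" for u v
  proof -
    interpret l: Vector_Spaces.linear scale scale "\<lambda>x. mult u x" by (rule linear_mult_right)
    have "mult u ` words_upto S j \<subseteq> lin S (i + j)"
    proof clarify
      fix x assume "x \<in> words_upto S j"
      then obtain i' j' where "i' \<le> i" "j' \<le> j" "word S i' u" "word S j' x"
        using u by (auto simp: words_upto_def)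
      then show "mult u x \<in> lin S (i + j)"
        using word_in_lin[OF word_mult] lin_monoD add_mono by metis
    qed
    then have "span (mult u ` words_upto S j) \<subseteq> lin S (i + j)"
      using span_minimal subspace_lin by blast
    then show ?thesis using v l.span_image[of "words_upto S j"] by (auto simp: lin_def)
  qed
  interpret l: Vector_Spaces.linear scale scale "\<lambda>x. mult x v" by (rule linear_mult_left)
  have "span ((\<lambda>x. mult x v) ` words_upto S i) \<subseteq> lin S (i + j)"
    by (rule span_minimal[OF _ subspace_lin]) (use 1 assms in auto)
  then show ?thesis using assms l.span_image[of "words_upto S i"] by (auto simp: lin_def)
qed

section \<open>Signs and alternating actions modulo lower terms\<close>

text \<open>Signs of rearrangements are never tracked: later arguments ask only whether an element
  falls into a lower level, and a sign does not affect that.\<close>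

definition eq_up_to_sign :: "'a set \<Rightarrow> nat \<Rightarrow> 'a \<Rightarrow> 'a \<Rightarrow> bool" where
  "eq_up_to_sign S n x y \<longleftrightarrow> x - y \<in> lin S n \<or> x + y \<in> lin S n"

lemma eq_up_to_sign_refl [simp]: "eq_up_to_sign S n x x"
  by (simp add: eq_up_to_sign_def lin_zero)

lemma eq_up_to_sign_sym: "eq_up_to_sign S n x y \<Longrightarrow> eq_up_to_sign S n y x"
  unfolding eq_up_to_sign_def by (metis add.commute lin_neg minus_diff_eq)

lemma eq_up_to_sign_trans:
  assumes "eq_up_to_sign S n x y" "eq_up_to_sign S n y z"
  shows "eq_up_to_sign S n x z"
proof -
  have "x - z = (x - y) + (y - z)" "x - z = (x + y) - (y + z)"
    "x + z = (x - y) + (y + z)" "x + z = (x + y) - (y - z)" by (simp_all add: algebra_simps)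
  then show ?thesis using assms unfolding eq_up_to_sign_def by (metis lin_add lin_diff)
qed

lemma eq_up_to_sign_mem_iff:
  assumes "eq_up_to_sign S n x y"
  shows "x \<in> lin S n \<longleftrightarrow> y \<in> lin S n"
proof -
  have "x = (x - y) + y" "x = (x + y) - y" "y = x - (x - y)" "y = (x + y) - x" by simp_all
  then show ?thesis using assms unfolding eq_up_to_sign_def by (metis lin_add lin_diff)
qed

lemma eq_up_to_sign_linear:
  assumes "eq_up_to_sign S n x y" "Vector_Spaces.linear scale scale f"
    and "\<And>z. z \<in> lin S n \<Longrightarrow> f z \<in> lin S m"
  shows "eq_up_to_sign S m (f x) (f y)"
proof -
  interpret l: Vector_Spaces.linear scale scale f by (rule assms)
  show ?thesis using assms(1,3) l.add l.diff unfolding eq_up_to_sign_def by metis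
qed

text \<open>A linear action of the letters that is alternating on the associated graded space
  of the filtration \<open>lin S\<close>.\<close>

definition alt_action :: "'a set \<Rightarrow> ('a \<Rightarrow> 'a \<Rightarrow> 'a) \<Rightarrow> bool" where
  "alt_action S f \<longleftrightarrow> (\<forall>a. Vector_Spaces.linear scale scale (f a)) \<and>
     (\<forall>a\<in>S. \<forall>n. \<forall>u\<in>lin S n. f a u \<in> lin S (Suc n)) \<and>
     (\<forall>a\<in>S. \<forall>b\<in>S. \<forall>n\<ge>1. \<forall>u\<in>lin S n. f a (f b u) + f b (f a u) \<in> lin S (Suc n)) \<and>
     (\<forall>a\<in>S. \<forall>n\<ge>1. \<forall>u\<in>lin S n. f a (f a u) \<in> lin S (Suc n))"

lemma alt_action_foldr_lin:
  assumes "alt_action S f" "set xs \<subseteq> S" "u \<in> lin S n"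
  shows "foldr f xs u \<in> lin S (length xs + n)"
  using assms(2,3) by (induction xs) (use assms(1) in \<open>auto simp: alt_action_def\<close>)

lemma alt_action_linear_foldr:
  "alt_action S f \<Longrightarrow> Vector_Spaces.linear scale scale (foldr f xs)"
  by (rule linear_foldr) (simp add: alt_action_def)

lemma alt_action_foldr_cong:
  assumes "alt_action S f" "set xs \<subseteq> S" "eq_up_to_sign S n u v" "m = length xs + n"
  shows "eq_up_to_sign S m (foldr f xs u) (foldr f xs v)"
  using eq_up_to_sign_linear[OF assms(3) alt_action_linear_foldr[OF assms(1)]]
    alt_action_foldr_lin[OF assms(1,2)] assms(4) by metis

text \<open>Each exchange of neighbours costs a sign and an error one degree below that of the whole
  word, which is \<open>Suc (length (bs @ cs) + n)\<close>.\<close>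

lemma alt_action_move:
  assumes "alt_action S f" "set (a # bs @ cs) \<subseteq> S" "u \<in> lin S n" "1 \<le> n"
  shows "eq_up_to_sign S (length (bs @ cs) + n) (foldr f (a # bs @ cs) u) (foldr f (bs @ a # cs) u)"
  using assms(2)
proof (induction bs)
  case Nil
  then show ?case by simp
next
  case (Cons b bs)
  let ?v = "foldr f (bs @ cs) u"
  have v: "?v \<in> lin S (length (bs @ cs) + n)"
    using Cons.prems by (intro alt_action_foldr_lin[OF assms(1) _ assms(3)]) auto
  have "f a (f b ?v) + f b (f a ?v) \<in> lin S (Suc (length (bs @ cs) + n))"
    using assms(1,4) Cons.prems v unfolding alt_action_def by auto
  then have 1: "eq_up_to_sign S (Suc (length (bs @ cs) + n)) (f a (f b ?v)) (f b (f a ?v))"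
    by (simp add: eq_up_to_sign_def)
  have "eq_up_to_sign S (Suc (length (bs @ cs) + n)) (f b (f a ?v)) (f b (foldr f (bs @ a # cs) u))"
    using alt_action_foldr_cong[OF assms(1) _ Cons.IH, of "[b]"] Cons.prems by simp
  from eq_up_to_sign_trans[OF 1 this] show ?case by simp
qed

text \<open>The tail is permuted underneath the outermost letter by induction;
  \<open>alt_action_move\<close> then carries that letter to its place in \<open>ys\<close>.\<close>

lemma alt_action_perm:
  assumes "alt_action S f" "set xs \<subseteq> S" "mset xs = mset ys" "u \<in> lin S n" "1 \<le> n"
  shows "eq_up_to_sign S (length xs + n - 1) (foldr f xs u) (foldr f ys u)"
  using assms(2,3)
proof (induction xs arbitrary: ys)
  case Nil
  then show ?case by simp
next
  case (Cons a xs)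
  then have "a \<in> set ys" by (metis list.set_intros(1) mset_eq_setD)
  then obtain bs cs where ys: "ys = bs @ a # cs" by (meson split_list)
  then have m: "mset xs = mset (bs @ cs)" using Cons.prems by simp
  then have len: "length xs = length (bs @ cs)" and st: "set xs = set (bs @ cs)"
    by (metis size_mset, metis mset_eq_setD)
  have IH: "eq_up_to_sign S (length xs + n - 1) (foldr f xs u) (foldr f (bs @ cs) u)"
    using Cons.IH[OF _ m] Cons.prems by auto
  have "eq_up_to_sign S (length xs + n) (foldr f (a # xs) u) (foldr f (a # bs @ cs) u)"
    using alt_action_foldr_cong[OF assms(1) _ IH, of "[a]" "length xs + n"] Cons.prems assms(5) by simp
  moreover have "eq_up_to_sign S (length xs + n) (foldr f (a # bs @ cs) u) (foldr f ys u)"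
    using alt_action_move[OF assms(1) _ assms(4,5), of a bs cs] Cons.prems len st ys by auto
  ultimately show ?case using eq_up_to_sign_trans by simp
qed

lemma alt_action_repeat:
  assumes "alt_action S f" "set xs \<subseteq> S" "\<not> distinct xs" "u \<in> lin S n" "1 \<le> n"
  shows "foldr f xs u \<in> lin S (length xs + n - 1)"
proof -
  obtain as bs cs a where xs: "xs = as @ [a] @ bs @ [a] @ cs"
    using assms(3) not_distinct_decomp by blast
  define zs where "zs = as @ bs @ cs"
  have "foldr f zs u \<in> lin S (length zs + n)"
    using assms(2) by (intro alt_action_foldr_lin[OF assms(1) _ assms(4)]) (auto simp: xs zs_def)
  \<comment> \<open>Once the two equal letters stand side by side, the square rule lowers the degree
    by one.\<close>
  then have "foldr f (a # a # zs) u \<in> lin S (Suc (length zs + n))"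
    using assms(1,2,5) xs unfolding alt_action_def by auto
  moreover have "eq_up_to_sign S (length xs + n - 1) (foldr f xs u) (foldr f (a # a # zs) u)"
    by (rule alt_action_perm[OF assms(1,2) _ assms(4,5)]) (simp add: xs zs_def)
  moreover have "length xs + n - 1 = Suc (length zs + n)" by (simp add: xs zs_def)
  ultimately show ?thesis using eq_up_to_sign_mem_iff by metis
qed

section \<open>A lower bound for the dimension\<close>

text \<open>In a linear relation modulo \<open>lin S 0\<close>, the term of largest degree with nonzero coefficient
  is isolated by its own test map; working modulo \<open>lin S 0\<close> gains the summand \<open>d0\<close>.\<close>

lemma card_add_d0_le_dim:
  fixes v :: "'i \<Rightarrow> 'a" and deg :: "'i \<Rightarrow> nat"
  assumes fd: finite_dim and K: "finite K" "K \<noteq> {}"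
    and deg: "\<And>i. i \<in> K \<Longrightarrow> 1 \<le> deg i \<and> deg i \<le> k"
    and v: "\<And>i. i \<in> K \<Longrightarrow> v i \<in> lin S (deg i)"
    and lin: "\<And>i. i \<in> K \<Longrightarrow> Vector_Spaces.linear scale scale (\<phi> i)"
    and filt: "\<And>i n z. i \<in> K \<Longrightarrow> z \<in> lin S n \<Longrightarrow> \<phi> i z \<in> lin S (n + (k - deg i))"
    and diag: "\<And>i. i \<in> K \<Longrightarrow> \<phi> i (v i) \<notin> lin S (k - 1)"
    and off: "\<And>i j. i \<in> K \<Longrightarrow> j \<in> K \<Longrightarrow> i \<noteq> j \<Longrightarrow> deg i = deg j \<Longrightarrow> \<phi> i (v j) \<in> lin S (k - 1)"
  shows "card K + d0 \<le> dim UNIV"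
proof -
  have ind: "\<forall>i\<in>K. c i = 0" if c: "(\<Sum>i\<in>K. scale (c i) (v i)) \<in> lin S 0" for c
  proof (rule ccontr)
    let ?C = "{i \<in> K. c i \<noteq> 0}"
    assume "\<not> ?thesis"
    then have "?C \<noteq> {}" and fC: "finite ?C" using K by auto
    then have "Max (deg ` ?C) \<in> deg ` ?C" by (intro Max_in) auto
    then obtain i where i: "i \<in> ?C" and "deg i = Max (deg ` ?C)" by auto
    then have mx: "\<And>j. j \<in> ?C \<Longrightarrow> deg j \<le> deg i" using fC by simp
    have iK: "i \<in> K" and ci: "c i \<noteq> 0" using i by auto
    interpret l: Vector_Spaces.linear scale scale "\<phi> i" by (rule lin[OF iK])
    have "(\<Sum>j\<in>K. scale (c j) (\<phi> i (v j))) = \<phi> i (\<Sum>j\<in>K. scale (c j) (v j))"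
      by (simp add: l.sum l.scale)
    \<comment> \<open>The relation lies in \<open>lin S 0\<close>, and \<open>\<phi> i\<close>
      raises levels by \<open>k - deg i\<close>, which is at most \<open>k - 1\<close> since
      \<open>deg i\<close> is positive.\<close>
    also have "\<dots> \<in> lin S (k - 1)"
      using filt[OF iK c] deg[OF iK] lin_monoD by fastforce
    finally have 1: "(\<Sum>j\<in>K. scale (c j) (\<phi> i (v j))) \<in> lin S (k - 1)" .
    have "scale (c j) (\<phi> i (v j)) \<in> lin S (k - 1)" if j: "j \<in> K - {i}" for j
    proof (cases "c j = 0")
      case True
      then show ?thesis by (simp add: lin_zero)
    next
      case False
      then have le: "deg j \<le> deg i" using mx j by auto
      show ?thesis
      proof (cases "deg j = deg i")
        case True
        then show ?thesis using off[OF iK, of j] j lin_scale by auto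
      next
        case False
        have jK: "j \<in> K" using j by auto
        \<comment> \<open>Terms of smaller degree land below level \<open>k\<close> by
          \<open>filt\<close> alone; only equal degrees need \<open>off\<close>.\<close>
        have "deg j + (k - deg i) \<le> k - 1" using False le deg[OF iK] by auto
        then show ?thesis using filt[OF iK v[OF jK]] lin_monoD lin_scale by blast
      qed
    qed
    then have "(\<Sum>j\<in>K - {i}. scale (c j) (\<phi> i (v j))) \<in> lin S (k - 1)" by (rule lin_sum)
    then have "scale (c i) (\<phi> i (v i)) \<in> lin S (k - 1)"
      using lin_diff[OF 1] sum.remove[OF K(1) iK, of "\<lambda>j. scale (c j) (\<phi> i (v j))"]
      by fastforce
    then have "scale (inverse (c i)) (scale (c i) (\<phi> i (v i))) \<in> lin S (k - 1)" by (rule lin_scale)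
    then show False using ci diag[OF iK] by simp
  qed
  have single: "(\<Sum>j\<in>K. scale (if j = i then a else 0) (v j)) = scale a (v i)" if "i \<in> K" for i a
  proof -
    have "(\<Sum>j\<in>K. scale (if j = i then a else 0) (v j)) = (\<Sum>j\<in>K. if j = i then scale a (v j) else 0)"
      by (rule sum.cong) auto
    then show ?thesis using K that by simp
  qed
  have inj: "inj_on v K"
  proof (rule inj_onI, rule ccontr)
    fix i j assume ij: "i \<in> K" "j \<in> K" "v i = v j" "i \<noteq> j"
    let ?c = "\<lambda>l. (if l = i then 1 else 0) - (if l = j then 1 else 0) :: 'f"
    have "(\<Sum>l\<in>K. scale (?c l) (v l)) = 0"
      unfolding scale_left_diff_distrib sum_subtractf single[OF ij(1)] single[OF ij(2)]
      using ij by simp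
    then have "\<forall>l\<in>K. ?c l = 0" by (intro ind) (simp only: lin_zero)
    from bspec[OF this ij(1)] show False using ij(4) by simp
  qed
  let ?E = "{e. is_unity e}"
  have uniq: "e = e'" if "is_unity e" "is_unity e'" for e e'
    using that unfolding is_unity_def by metis
  have E: "finite ?E" "card ?E = d0"
  proof -
    have "finite ?E \<and> card ?E = d0"
    proof (cases unital)
      case True
      then obtain e where "is_unity e" by (auto simp: unital_def)
      then have "?E = {e}" using uniq by auto
      then show ?thesis using True by (simp add: d0_def)
    next
      case False
      then show ?thesis by (simp add: d0_def unital_def)
    qed
    then show "finite ?E" "card ?E = d0" by auto
  qed
  \<comment> \<open>A zero unity would make the algebra trivial, contradicting
    \<open>diag\<close>.\<close>
  have nz: "e \<noteq> 0" if "is_unity e" for e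
  proof
    assume e0: "e = 0"
    obtain i where i: "i \<in> K" using K by auto
    have "mult 0 z = 0" for z using mult_add_left[of 0 0 z] by simp
    then have "z = 0" for z :: 'a using that[unfolded is_unity_def, rule_format, of z] e0 by simp
    then show False using diag[OF i] lin_zero by metis
  qed
  \<comment> \<open>A \<open>v i\<close> equal to the unity would be a one-term relation modulo
    \<open>lin S 0\<close>.\<close>
  have disj: "v ` K \<inter> ?E = {}"
  proof (rule ccontr)
    assume "\<not> ?thesis"
    then obtain i where i: "i \<in> K" "is_unity (v i)" by auto
    then have "(\<Sum>j\<in>K. scale (if j = i then 1 else 0) (v j)) \<in> lin S 0"
      using unity_in_lin by (simp add: single)
    from ind[OF this] i show False by auto
  qed
  have "independent (v ` K \<union> ?E)"
  proof (rule independent_if_scalars_zero)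
    show "finite (v ` K \<union> ?E)" using K E by simp
    fix f x assume s: "(\<Sum>x\<in>v ` K \<union> ?E. scale (f x) x) = 0" and x: "x \<in> v ` K \<union> ?E"
    have split: "(\<Sum>x\<in>v ` K \<union> ?E. scale (f x) x) =
        (\<Sum>i\<in>K. scale (f (v i)) (v i)) + (\<Sum>e\<in>?E. scale (f e) e)"
      using K E disj inj by (simp add: sum.union_disjoint sum.reindex)
    \<comment> \<open>The unity part of a relation is absorbed into \<open>lin S 0\<close>, so
      \<open>ind\<close> annihilates the other coefficients first.\<close>
    have "(\<Sum>e\<in>?E. scale (f e) e) \<in> lin S 0"
      by (rule lin_sum) (auto intro: lin_scale unity_in_lin)
    then have "(\<Sum>i\<in>K. scale (f (v i)) (v i)) \<in> lin S 0"
      using lin_neg split s by (fastforce simp: eq_neg_iff_add_eq_0[symmetric])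
    then have fv: "\<forall>i\<in>K. f (v i) = 0" by (rule ind)
    show "f x = 0"
    proof (cases "x \<in> v ` K")
      case True
      then show ?thesis using fv by auto
    next
      case False
      then have xu: "is_unity x" using x by auto
      then have Ex: "?E = {x}" using uniq by auto
      have "(\<Sum>e\<in>?E. scale (f e) e) = 0" using split s fv by simp
      then show ?thesis using nz[OF xu] unfolding Ex by simp
    qed
  qed
  moreover obtain B where B: "finite B" "span B = UNIV" using fd by (auto simp: finite_dim_def)
  obtain B' where B': "B' \<subseteq> B" "independent B'" "B \<subseteq> span B'"
    using maximal_independent_subset[of B] by metis
  have sp: "span B' = UNIV" using B B' by (metis span_mono span_span top.extremum_uniqueI)
  have "dim UNIV = card B'" using dim_eq_card[of B' UNIV] B' sp by simp
  moreover have "finite B'" using B B' finite_subset by blast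
  ultimately have "card (v ` K \<union> ?E) \<le> dim UNIV"
    using independent_span_bound[of B' "v ` K \<union> ?E"] sp by auto
  then show ?thesis using card_Un_disjoint[OF _ E(1) disj] K E card_image[OF inj] by simp
qed

section \<open>Descending alternativity in terms of the filtration\<close>

abbreviation (input) rmult :: "'a \<Rightarrow> 'a \<Rightarrow> 'a" where
  "rmult b u \<equiv> mult u b"

context
  fixes S :: "'a set"
  assumes da: descendingly_alternative
begin

lemma L2'_subset:
  assumes "a \<in> lin S p" "b \<in> lin S q" "c \<in> lin S r" "p + q \<le> m" "q + r \<le> m" "p + r \<le> m"
  shows "L2' a b c \<subseteq> lin S m"
proof -
  have "mult x y \<in> lin S m" if "x \<in> lin S i" "y \<in> lin S j" "i + j \<le> m" for x y i j
    using lin_monoD[OF lin_mult] that by blast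
  note * = this[OF assms(1,2)] this[OF assms(2,1)] this[OF assms(2,3)] this[OF assms(3,2)]
    this[OF assms(1,3)] this[OF assms(3,1)]
  have "a \<in> lin S m" "b \<in> lin S m" "c \<in> lin S m"
    using assms by (auto elim!: lin_monoD)
  with * show ?thesis unfolding L2'_def using assms(4-6)
    by (intro span_minimal subspace_lin) (auto intro: unity_in_lin)
qed

text \<open>Every generator of \<open>L2' a b c\<close> other than the unity omits at least one of
  the three factors, each of degree at least 1, so its degree is below
  \<open>p + q + r\<close>.\<close>

lemma alt_right:
  assumes "a \<in> lin S p" "b \<in> lin S q" "c \<in> lin S r" "1 \<le> p" "1 \<le> q" "1 \<le> r" "Suc m = p + q + r"
  shows "mult (mult a b) c + mult (mult a c) b \<in> lin S m"
  using L2'_subset[OF assms(1-3), of m] da assms(4-)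
  unfolding descendingly_alternative_def by (auto simp: subset_iff)

lemma alt_left:
  assumes "a \<in> lin S p" "b \<in> lin S q" "c \<in> lin S r" "1 \<le> p" "1 \<le> q" "1 \<le> r" "Suc m = p + q + r"
  shows "mult a (mult b c) + mult b (mult a c) \<in> lin S m"
  using L2'_subset[OF assms(1-3), of m] da assms(4-)
  unfolding descendingly_alternative_def by (auto simp: subset_iff)

text \<open>The generator \<open>mult a a\<close> of \<open>L1 a u\<close> has degree 2, which is
  within \<open>Suc n\<close> because \<open>1 \<le> n\<close>.\<close>

lemma alt_square:
  assumes "a \<in> S" "u \<in> lin S n" "1 \<le> n"
  shows "mult a (mult a u) \<in> lin S (Suc n)" "mult (mult u a) a \<in> lin S (Suc n)"
proof -
  have a: "a \<in> lin S 1" by (rule gen_in_lin[OF assms(1)])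
  have "L1 a u \<subseteq> lin S (Suc n)"
    unfolding L1_def using lin_mult[OF a a] lin_mult[OF a assms(2)] lin_mult[OF assms(2) a]
      lin_monoD[OF a] lin_monoD[OF assms(2)] lin_monoD[of _ S "1 + 1" "Suc n"] assms(3)
    by (intro span_minimal subspace_lin) (auto intro: unity_in_lin)
  then show "mult a (mult a u) \<in> lin S (Suc n)" "mult (mult u a) a \<in> lin S (Suc n)"
    using da unfolding descendingly_alternative_def by auto
qed

text \<open>The alternating laws start at level 1: for the unity as \<open>u\<close> they would ask
  \<open>mult a b + mult b a\<close> to lie in \<open>lin S 1\<close>, which the axioms do not
  give.\<close>

lemma alt_action_mult: "alt_action S mult"
proof -
  have "mult a u \<in> lin S (Suc n)" if "a \<in> S" "u \<in> lin S n" for a u n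
    using lin_mult[OF gen_in_lin] that by fastforce
  moreover have "mult a (mult b u) + mult b (mult a u) \<in> lin S (Suc n)"
    if "a \<in> S" "b \<in> S" "u \<in> lin S n" "1 \<le> n" for a b u n
    using alt_left[OF gen_in_lin gen_in_lin] that by auto
  ultimately show ?thesis
    using linear_mult_right alt_square(1) unfolding alt_action_def by auto
qed

lemma alt_action_rmult: "alt_action S rmult"
proof -
  have "mult u a \<in> lin S (Suc n)" if "a \<in> S" "u \<in> lin S n" for a u n
    using lin_mult[OF _ gen_in_lin] that by fastforce
  moreover have "mult (mult u b) a + mult (mult u a) b \<in> lin S (Suc n)"
    if "a \<in> S" "b \<in> S" "u \<in> lin S n" "1 \<le> n" for a b u n
    using alt_right[OF _ gen_in_lin gen_in_lin] that by auto
  ultimately show ?thesis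
    using linear_mult_left alt_square(2) unfolding alt_action_def by auto
qed

lemmas foldr_mult_lin = alt_action_foldr_lin[OF alt_action_mult]
lemmas foldr_rmult_lin = alt_action_foldr_lin[OF alt_action_rmult]
lemmas foldr_mult_cong = alt_action_foldr_cong[OF alt_action_mult]
lemmas foldr_rmult_cong = alt_action_foldr_cong[OF alt_action_rmult]

section \<open>Commutation of left and right multiplications\<close>

text \<open>On a single letter the axioms do not relate left and right multiplications, so
  commutation is stated for products. The factors may be any elements of positive level, which makes
  the notion stable under further multiplication by letters.\<close>

definition decomposable :: "nat \<Rightarrow> 'a \<Rightarrow> bool" where
  "decomposable n u \<longleftrightarrow>
     (\<exists>c d i j. 1 \<le> i \<and> 1 \<le> j \<and> n = i + j \<and> c \<in> lin S i \<and> d \<in> lin S j \<and> u = mult c d)"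

lemma decomposable_lin: "decomposable n u \<Longrightarrow> u \<in> lin S n"
  unfolding decomposable_def using lin_mult by blast

lemma decomposable_mult:
  assumes "c \<in> lin S i" "d \<in> lin S j" "1 \<le> i" "1 \<le> j" "n = i + j"
  shows "decomposable n (mult c d)"
  using assms unfolding decomposable_def by blast

lemma decomposable_foldr_mult:
  "decomposable n u \<Longrightarrow> set as \<subseteq> S \<Longrightarrow> decomposable (length as + n) (foldr mult as u)"
proof (induction as)
  case (Cons a as)
  then have "foldr mult as u \<in> lin S (length as + n)" using decomposable_lin by auto
  moreover have "1 \<le> n" using Cons.prems(1) by (auto simp: decomposable_def)
  ultimately show ?case using decomposable_mult[OF gen_in_lin] Cons.prems(2) by auto
qed simp

lemma decomposable_foldr_mult_gen:
  assumes "set as \<subseteq> S" "as \<noteq> []" "y \<in> S"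
  shows "decomposable (Suc (length as)) (foldr mult as y)"
proof -
  have "as = butlast as @ [last as]" using assms by simp
  then have "foldr mult as y = foldr mult (butlast as) (mult (last as) y)"
    by (metis foldr.simps(2) foldr_append foldr_Nil id_apply comp_apply)
  moreover have "decomposable 2 (mult (last as) y)"
    using assms by (intro decomposable_mult[of _ 1 _ 1] gen_in_lin) auto
  moreover have "set (butlast as) \<subseteq> S" using assms by (auto dest: in_set_butlastD)
  ultimately show ?thesis
    using decomposable_foldr_mult[of 2 _ "butlast as"] assms(2) by (simp add: Suc_diff_Suc)
qed

text \<open>Modulo lower terms the products of two decomposable elements commute:
  \<open>(cd)(ab) = -(ad)(cb) = (ab)(cd)\<close>, and both \<open>a(ub)\<close> and \<open>(au)b\<close> reduce to such products.\<close>

lemma left_right_commute: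
  assumes ab: "a \<in> S" "b \<in> S" and u: "decomposable n u"
  shows "mult a (mult u b) - mult (mult a u) b \<in> lin S (Suc n)"
proof -
  obtain c d i j where ij: "1 \<le> i" "1 \<le> j" "n = i + j" and c: "c \<in> lin S i" and d: "d \<in> lin S j"
    and ucd: "u = mult c d" using u unfolding decomposable_def by blast
  have a: "a \<in> lin S 1" and b: "b \<in> lin S 1" using ab gen_in_lin by auto
  have uL: "u \<in> lin S (i + j)" using lin_mult[OF c d] ucd by simp
  note m = lin_mult
  have h1: "mult a (mult u b) + mult u (mult a b) \<in> lin S (Suc n)"
    using alt_left[OF a uL b] ij by simp
  \<comment> \<open>Modulo lower terms, \<open>h2\<close> to \<open>h7\<close> read (cd)(ab) =
    -(c(ab))d = (a(cb))d = -(ad)(cb) = c((ad)b) = -c((ab)d) = (ab)(cd).\<close>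
  have h2: "mult (mult c d) (mult a b) + mult (mult c (mult a b)) d \<in> lin S (Suc n)"
    using alt_right[OF c d m[OF a b]] ij by (simp add: add_ac)
  have "mult c (mult a b) + mult a (mult c b) \<in> lin S (Suc i)"
    using alt_left[OF c a b] ij by simp
  from m[OF this d]
  have h3: "mult (mult c (mult a b)) d + mult (mult a (mult c b)) d \<in> lin S (Suc n)"
    using ij by (simp add: mult_add_left)
  have h4: "mult (mult a (mult c b)) d + mult (mult a d) (mult c b) \<in> lin S (Suc n)"
    using alt_right[OF a m[OF c b] d] ij by simp
  have h5: "mult (mult a d) (mult c b) + mult c (mult (mult a d) b) \<in> lin S (Suc n)"
    using alt_left[OF m[OF a d] c b] ij by (simp add: add_ac)
  have "mult (mult a d) b + mult (mult a b) d \<in> lin S (Suc j)"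
    using alt_right[OF a d b] ij by simp
  from m[OF c this]
  have h6: "mult c (mult (mult a d) b) + mult c (mult (mult a b) d) \<in> lin S (Suc n)"
    using ij by (simp add: mult_add_right)
  have h7: "mult c (mult (mult a b) d) + mult (mult a b) (mult c d) \<in> lin S (Suc n)"
    using alt_left[OF c m[OF a b] d] ij by simp
  have h8: "mult (mult a b) u + mult (mult a u) b \<in> lin S (Suc n)"
    using alt_right[OF a b uL] ij by simp
  \<comment> \<open>The sum h1 - (h2 - h3 + h4 - h5 + h6 - h7) - h8 telescopes to the claim.\<close>
  note lin_diff[OF lin_diff[OF h1 lin_diff[OF lin_add[OF lin_diff[OF lin_add[OF
    lin_diff[OF h2 h3] h4] h5] h6] h7]] h8]
  then show ?thesis by (simp add: ucd algebra_simps)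
qed

text \<open>Decomposability is carried through the induction because each step applies
  \<open>left_right_commute\<close> to the product built so far.\<close>

lemma mult_foldr_rmult_commute:
  assumes "a \<in> S" "set ys \<subseteq> S" "decomposable n u"
  shows "eq_up_to_sign S (length ys + n) (mult a (foldr rmult ys u)) (foldr rmult ys (mult a u))
    \<and> decomposable (length ys + n) (foldr rmult ys u)"
  using assms(2)
proof (induction ys)
  case (Cons b ys)
  let ?v = "foldr rmult ys u"
  have v: "decomposable (length ys + n) ?v" using Cons by simp
  have "eq_up_to_sign S (Suc (length ys + n)) (mult a (mult ?v b)) (mult (mult a ?v) b)"
    using left_right_commute[OF assms(1) _ v] Cons.prems by (simp add: eq_up_to_sign_def)
  moreover have "eq_up_to_sign S (Suc (length ys + n)) (mult (mult a ?v) b)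
      (mult (foldr rmult ys (mult a u)) b)"
    using foldr_rmult_cong[of "[b]" "length ys + n"] Cons by simp
  moreover have "decomposable (Suc (length ys + n)) (mult ?v b)"
    using v decomposable_mult[OF decomposable_lin[OF v] gen_in_lin] Cons.prems assms(3)
    by (auto simp: decomposable_def)
  ultimately show ?case using eq_up_to_sign_trans by simp
qed (use assms in simp)

lemma foldr_mult_foldr_rmult_commute:
  assumes "set as \<subseteq> S" "set ys \<subseteq> S" "decomposable n u"
  shows "eq_up_to_sign S (length as + length ys + n - 1)
    (foldr mult as (foldr rmult ys u)) (foldr rmult ys (foldr mult as u))"
  using assms(1)
proof (induction as)
  case (Cons a as)
  have n: "1 \<le> n" using assms(3) by (auto simp: decomposable_def)
  have "eq_up_to_sign S (length as + length ys + n)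
      (mult a (foldr mult as (foldr rmult ys u))) (mult a (foldr rmult ys (foldr mult as u)))"
    using foldr_mult_cong[of "[a]" "length as + length ys + n - 1"] Cons n by simp
  moreover have "eq_up_to_sign S (length as + length ys + n)
      (mult a (foldr rmult ys (foldr mult as u))) (foldr rmult ys (mult a (foldr mult as u)))"
    using mult_foldr_rmult_commute[OF _ assms(2) decomposable_foldr_mult[OF assms(3)], of a as]
      Cons.prems by (simp add: add_ac)
  ultimately show ?case using eq_up_to_sign_trans by simp
qed simp

section \<open>The normal form and its symmetries\<close>

text \<open>The normal form of words; modulo lower terms it is alternating in \<open>xs\<close> and in \<open>ys\<close>.
  Empty \<open>ys\<close> is junk, and empty \<open>xs\<close> is used only with \<open>length ys = 1\<close>, where the value is a letter.\<close>

definition bialt :: "'a list \<Rightarrow> 'a list \<Rightarrow> 'a" where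
  "bialt xs ys = foldr rmult (butlast ys) (foldr mult xs (last ys))"

lemma set_butlast_subset: "set ys \<subseteq> A \<Longrightarrow> set (butlast ys) \<subseteq> A"
  by (auto dest: in_set_butlastD)

lemma last_subset: "set ys \<subseteq> A \<Longrightarrow> ys \<noteq> [] \<Longrightarrow> last ys \<in> A"
  by auto

lemma bialt_lin:
  assumes "set xs \<subseteq> S" "set ys \<subseteq> S" "ys \<noteq> []"
  shows "bialt xs ys \<in> lin S (length xs + length ys)"
proof -
  have "length (butlast ys) + (length xs + 1) = length xs + length ys"
    using assms(3) by (cases ys) auto
  then show ?thesis unfolding bialt_def
    using foldr_rmult_lin[OF set_butlast_subset[OF assms(2)]
        foldr_mult_lin[OF assms(1) gen_in_lin[OF last_subset[OF assms(2,3)]]]] by metis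
qed

text \<open>Both sides grow from the product of \<open>last xs\<close> and \<open>last ys\<close>.
  On the right-hand side all of \<open>ys\<close> acts on one letter, which makes the alternation in
  \<open>ys\<close> visible, as \<open>bialt\<close> does for \<open>xs\<close>.\<close>

lemma bialt_swap_order:
  assumes "set xs \<subseteq> S" "set ys \<subseteq> S" "xs \<noteq> []" "ys \<noteq> []"
  shows "eq_up_to_sign S (length xs + length ys - 1) (bialt xs ys)
    (foldr mult (butlast xs) (foldr rmult ys (last xs)))"
proof -
  obtain xs' x where xs: "xs = xs' @ [x]" using assms(3) by (cases xs rule: rev_cases) auto
  obtain ys' y where ys: "ys = ys' @ [y]" using assms(4) by (cases ys rule: rev_cases) auto
  have "decomposable 2 (mult x y)"
    using assms xs ys by (intro decomposable_mult[of _ 1 _ 1] gen_in_lin) auto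
  then have "eq_up_to_sign S (length xs' + length ys' + 2 - 1)
      (foldr mult xs' (foldr rmult ys' (mult x y))) (foldr rmult ys' (foldr mult xs' (mult x y)))"
    using assms(1,2) xs ys by (intro foldr_mult_foldr_rmult_commute) auto
  then show ?thesis using eq_up_to_sign_sym by (simp add: bialt_def xs ys)
qed

lemma bialt_perm_left:
  assumes "set xs \<subseteq> S" "set ys \<subseteq> S" "ys \<noteq> []" "mset xs = mset xs'"
  shows "eq_up_to_sign S (length xs + length ys - 1) (bialt xs ys) (bialt xs' ys)"
proof -
  have "eq_up_to_sign S (length xs) (foldr mult xs (last ys)) (foldr mult xs' (last ys))"
    using alt_action_perm[OF alt_action_mult assms(1,4) gen_in_lin[OF last_subset[OF assms(2,3)]]]
    by simp
  from foldr_rmult_cong[OF set_butlast_subset[OF assms(2)] this] show ?thesis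
    unfolding bialt_def using assms(3) by (cases ys) (auto simp: add_ac)
qed

text \<open>Permute \<open>xs\<close>, swap the order of multiplications, permute \<open>ys\<close>,
  and swap back.\<close>

lemma bialt_perm:
  assumes "set xs \<subseteq> S" "set ys \<subseteq> S" "xs \<noteq> []" "ys \<noteq> []" "mset xs = mset xs'" "mset ys = mset ys'"
  shows "eq_up_to_sign S (length xs + length ys - 1) (bialt xs ys) (bialt xs' ys')"
proof -
  have xs': "set xs' \<subseteq> S" "xs' \<noteq> []" "length xs' = length xs"
    using assms(1,3) mset_eq_setD[OF assms(5)] mset_eq_length[OF assms(5)] by auto
  have ys': "set ys' \<subseteq> S" "ys' \<noteq> []" "length ys' = length ys"
    using assms(2,4) mset_eq_setD[OF assms(6)] mset_eq_length[OF assms(6)] by auto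
  have "eq_up_to_sign S (length ys) (foldr rmult ys (last xs')) (foldr rmult ys' (last xs'))"
    using alt_action_perm[OF alt_action_rmult assms(2,6) gen_in_lin[OF last_subset[OF xs'(1,2)]]]
    by simp
  from foldr_mult_cong[OF set_butlast_subset[OF xs'(1)] this]
  have "eq_up_to_sign S (length xs + length ys - 1)
     (foldr mult (butlast xs') (foldr rmult ys (last xs')))
     (foldr mult (butlast xs') (foldr rmult ys' (last xs')))"
    using xs'(2) unfolding xs'(3)[symmetric] by (cases xs') (auto simp: add_ac)
  note bialt_perm_left[OF assms(1,2,4,5)]
    bialt_swap_order[OF xs'(1) assms(2) xs'(2) assms(4), unfolded xs'(3)] this
    bialt_swap_order[OF xs'(1) ys'(1) xs'(2) ys'(2), unfolded xs'(3) ys'(3), THEN eq_up_to_sign_sym]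
  from eq_up_to_sign_trans[OF this(1) eq_up_to_sign_trans[OF this(2) eq_up_to_sign_trans[OF this(3,4)]]]
  show ?thesis .
qed

lemma bialt_repeat:
  assumes "set xs \<subseteq> S" "set ys \<subseteq> S" "xs \<noteq> []" "ys \<noteq> []" "\<not> distinct xs \<or> \<not> distinct ys"
  shows "bialt xs ys \<in> lin S (length xs + length ys - 1)"
  using assms(5)
proof
  assume "\<not> distinct xs"
  from alt_action_repeat[OF alt_action_mult assms(1) this gen_in_lin[OF last_subset[OF assms(2,4)]]]
  have "foldr mult xs (last ys) \<in> lin S (length xs)" by simp
  from foldr_rmult_lin[OF set_butlast_subset[OF assms(2)] this] show ?thesis
    unfolding bialt_def using assms(4) by (cases ys) (auto simp: add_ac)
next
  assume "\<not> distinct ys"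
  from alt_action_repeat[OF alt_action_rmult assms(2) this gen_in_lin[OF last_subset[OF assms(1,3)]]]
  have "foldr rmult ys (last xs) \<in> lin S (length ys)" by simp
  from foldr_mult_lin[OF set_butlast_subset[OF assms(1)] this]
  have "foldr mult (butlast xs) (foldr rmult ys (last xs)) \<in> lin S (length xs + length ys - 1)"
    using assms(3) by (cases xs) auto
  then show ?thesis using eq_up_to_sign_mem_iff[OF bialt_swap_order[OF assms(1-4)]] by blast
qed

text \<open>The letters \<open>as\<close> must pass the right multiplications already present. This
  is commutation on a decomposable element if \<open>xs\<close> is nonempty; otherwise
  \<open>ys\<close> is a single letter and there is nothing to pass.\<close>

lemma bialt_extend:
  assumes "set as \<subseteq> S" "set bs \<subseteq> S" "set xs \<subseteq> S" "set ys \<subseteq> S" "ys \<noteq> []"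
    and "xs \<noteq> [] \<or> length ys = 1"
  shows "eq_up_to_sign S (length as + length bs + length xs + length ys - 1)
    (foldr rmult bs (foldr mult as (bialt xs ys))) (bialt (as @ xs) (bs @ ys))"
proof -
  obtain ys' y where ys: "ys = ys' @ [y]" using assms(5) by (cases ys rule: rev_cases) auto
  then have y: "y \<in> S" "set ys' \<subseteq> S" using assms(4) by auto
  have "eq_up_to_sign S (length as + length ys' + Suc (length xs) - 1)
    (foldr mult as (foldr rmult ys' (foldr mult xs y))) (foldr rmult ys' (foldr mult as (foldr mult xs y)))"
  proof (cases "xs = []")
    case True
    then show ?thesis using assms(6) by (simp add: ys)
  next
    case False
    from foldr_mult_foldr_rmult_commute[OF assms(1) y(2)
      decomposable_foldr_mult_gen[OF assms(3) this y(1)]]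
    show ?thesis .
  qed
  from foldr_rmult_cong[OF assms(2) this refl]
  show ?thesis by (simp add: bialt_def ys butlast_append add_ac)
qed

section \<open>Reduction of words to normal forms\<close>

definition normal_span :: "nat \<Rightarrow> 'a set" where
  "normal_span n = span ({bialt xs ys | xs ys. set xs \<subseteq> S \<and> set ys \<subseteq> S \<and> xs \<noteq> [] \<and> ys \<noteq> [] \<and>
     length xs + length ys = n} \<union> lin S (n - 1))"

lemma bialt_in_normal_span:
  assumes "set xs \<subseteq> S" "set ys \<subseteq> S" "xs \<noteq> []" "ys \<noteq> []" "length xs + length ys = n"
    and "eq_up_to_sign S (n - 1) z (bialt xs ys)"
  shows "z \<in> normal_span n"
proof -
  have "bialt xs ys \<in> normal_span n"
    unfolding normal_span_def using assms(1-5) by (intro span_base) auto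
  moreover have "w \<in> normal_span n" if "w \<in> lin S (n - 1)" for w
    unfolding normal_span_def using that by (intro span_base) auto
  ultimately have "(z - bialt xs ys) + bialt xs ys \<in> normal_span n \<or>
      (z + bialt xs ys) - bialt xs ys \<in> normal_span n"
    using assms(6) span_add span_diff unfolding eq_up_to_sign_def normal_span_def by blast
  then show ?thesis by simp
qed

lemma linear_normal_span:
  assumes "z \<in> normal_span n" "Vector_Spaces.linear scale scale f"
    and "\<And>xs ys. set xs \<subseteq> S \<Longrightarrow> set ys \<subseteq> S \<Longrightarrow> xs \<noteq> [] \<Longrightarrow> ys \<noteq> [] \<Longrightarrow> length xs + length ys = n \<Longrightarrow>
      f (bialt xs ys) \<in> normal_span m"
    and "\<And>w. w \<in> lin S (n - 1) \<Longrightarrow> f w \<in> lin S (m - 1)"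
  shows "f z \<in> normal_span m"
proof -
  interpret l: Vector_Spaces.linear scale scale f by (rule assms)
  let ?B = "{bialt xs ys | xs ys. set xs \<subseteq> S \<and> set ys \<subseteq> S \<and> xs \<noteq> [] \<and> ys \<noteq> [] \<and>
     length xs + length ys = n} \<union> lin S (n - 1)"
  have "lin S (m - 1) \<subseteq> normal_span m"
    unfolding normal_span_def by (intro subsetI span_base) simp
  then have "f ` ?B \<subseteq> normal_span m" using assms(3,4) by blast
  then have "span (f ` ?B) \<subseteq> normal_span m"
    unfolding normal_span_def by (rule span_minimal) (rule subspace_span)
  moreover have "f z \<in> span (f ` ?B)"
    unfolding l.span_image using assms(1) unfolding normal_span_def by (rule imageI)
  ultimately show ?thesis by blast
qed

lemma gen_mult_normal_span:
  assumes "z \<in> normal_span n" "s \<in> S" "1 \<le> n"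
  shows "mult s z \<in> normal_span (Suc n)" "mult z s \<in> normal_span (Suc n)"
proof -
  show "mult s z \<in> normal_span (Suc n)"
  proof (rule linear_normal_span[OF assms(1) linear_mult_right])
    fix xs ys assume *: "set xs \<subseteq> S" "set ys \<subseteq> S" "xs \<noteq> []" "ys \<noteq> []" "length xs + length ys = n"
    show "mult s (bialt xs ys) \<in> normal_span (Suc n)"
      by (rule bialt_in_normal_span[of "s # xs" ys]) (use * assms(2) bialt_extend[of "[s]" "[]" xs ys] in auto)
  next
    show "mult s w \<in> lin S (Suc n - 1)" if "w \<in> lin S (n - 1)" for w
      using lin_mult[OF gen_in_lin[OF assms(2)] that] assms(3) by simp
  qed
  show "mult z s \<in> normal_span (Suc n)"
  proof (rule linear_normal_span[OF assms(1) linear_mult_left])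
    fix xs ys assume *: "set xs \<subseteq> S" "set ys \<subseteq> S" "xs \<noteq> []" "ys \<noteq> []" "length xs + length ys = n"
    show "mult (bialt xs ys) s \<in> normal_span (Suc n)"
      by (rule bialt_in_normal_span[of xs "s # ys"]) (use * assms(2) bialt_extend[of "[]" "[s]" xs ys] in auto)
  next
    show "mult w s \<in> lin S (Suc n - 1)" if "w \<in> lin S (n - 1)" for w
      using lin_mult[OF that gen_in_lin[OF assms(2)]] assms(3) by simp
  qed
qed

lemma word_1: "word S 1 w \<Longrightarrow> w \<in> S"
  by (cases rule: word.cases) auto

lemma word_decompose:
  assumes "word S n w" "2 \<le> n"
  obtains i j u v where "word S i u" "word S j v" "1 \<le> i" "1 \<le> j" "n = i + j" "w = mult u v"
  using assms by (cases rule: word.cases) auto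

lemma diff_lower_normal_span:
  assumes "x + y \<in> lin S (n - 1)" "y \<in> normal_span n"
  shows "x \<in> normal_span n"
proof -
  have "x + y \<in> normal_span n"
    unfolding normal_span_def using assms(1) by (intro span_base) auto
  then have "(x + y) - y \<in> normal_span n"
    using assms(2) unfolding normal_span_def by (intro span_diff)
  then show ?thesis by simp
qed

text \<open>\<open>(ab)v = -(av)b\<close> and \<open>u(cd) = -c(ud)\<close> decrease the length of the shorter factor until
  it is a letter.\<close>

lemma word_in_normal_span: "word S n w \<Longrightarrow> 2 \<le> n \<Longrightarrow> w \<in> normal_span n"
proof (induction n arbitrary: w rule: less_induct)
  case (less n)
  note IH = less.IH
  have "mult u v \<in> normal_span n"
    if "word S i u" "word S j v" "1 \<le> i" "1 \<le> j" "n = i + j" for i j u v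
    using that
  proof (induction "min i j" arbitrary: i j u v rule: less_induct)
    case less
    note uL = word_in_lin[OF less.prems(1)] and vL = word_in_lin[OF less.prems(2)]
    consider "i = 1" "j = 1" | "i = 1" "2 \<le> j" | "2 \<le> i" "j = 1"
      | "2 \<le> i" "i \<le> j" | "2 \<le> j" "j < i" using less.prems by linarith
    then show ?case
    proof cases
      case 1
      then have "u \<in> S" "v \<in> S" using less.prems word_1[of u] word_1[of v] by simp_all
      then show ?thesis
        by (intro bialt_in_normal_span[of "[u]" "[v]"]) (use 1 less.prems in \<open>auto simp: bialt_def\<close>)
    next
      \<comment> \<open>A letter times a longer word is settled by the outer induction on
        \<open>n\<close>; the inner one runs on \<open>min i j\<close>.\<close>
      case 2
      then have "v \<in> normal_span j" "u \<in> S"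
        using less.prems IH[of j v] word_1[of u] by simp_all
      then show ?thesis using gen_mult_normal_span(1)[of v j u] 2 less.prems by simp
    next
      case 3
      then have "u \<in> normal_span i" "v \<in> S"
        using less.prems IH[of i u] word_1[of v] by simp_all
      then show ?thesis using gen_mult_normal_span(2)[of u i v] 3 less.prems by simp
    next
      \<comment> \<open>The new right factor \<open>b\<close> has length \<open>q < i\<close>, so
        the minimum drops; in the last case \<open>c\<close>, of length \<open>p < j\<close>, plays
        this part.\<close>
      case 4
      obtain p q a b where ab: "word S p a" "word S q b" "1 \<le> p" "1 \<le> q" "i = p + q" "u = mult a b"
        by (rule word_decompose[OF less.prems(1) 4(1)])
      have "mult (mult a b) v + mult (mult a v) b \<in> lin S (n - 1)"
        by (rule alt_right[OF word_in_lin[OF ab(1)] word_in_lin[OF ab(2)] vL])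
          (use ab less.prems in auto)
      moreover have "mult (mult a v) b \<in> normal_span n"
        by (rule less.hyps[of "p + j" q])
          (use 4 ab less.prems word.prod[OF ab(1) less.prems(2)] in auto)
      ultimately show ?thesis unfolding ab(6) by (rule diff_lower_normal_span)
    next
      case 5
      obtain p q c d where cd: "word S p c" "word S q d" "1 \<le> p" "1 \<le> q" "j = p + q" "v = mult c d"
        by (rule word_decompose[OF less.prems(2) 5(1)])
      have "mult u (mult c d) + mult c (mult u d) \<in> lin S (n - 1)"
        by (rule alt_left[OF uL word_in_lin[OF cd(1)] word_in_lin[OF cd(2)]])
          (use cd less.prems in auto)
      moreover have "mult c (mult u d) \<in> normal_span n"
        by (rule less.hyps[of p "i + q"])
          (use 5 cd less.prems word.prod[OF less.prems(1) cd(2)] in auto)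
      ultimately show ?thesis unfolding cd(6) by (rule diff_lower_normal_span)
    qed
  qed
  moreover obtain i j u v where "word S i u" "word S j v" "1 \<le> i" "1 \<le> j" "n = i + j" "w = mult u v"
    by (rule word_decompose[OF less.prems])
  ultimately show ?case by blast
qed

text \<open>If every normal form of degree \<open>k\<close> were of lower level, so would be all of
  \<open>normal_span k\<close>, hence every word of length \<open>k\<close>.\<close>

lemma exists_nonzero_bialt:
  assumes "lin S k \<noteq> lin S (k - 1)" "2 \<le> k"
  obtains xs ys where "set xs \<subseteq> S" "set ys \<subseteq> S" "xs \<noteq> []" "ys \<noteq> []"
    "length xs + length ys = k" "bialt xs ys \<notin> lin S (k - 1)"
proof (rule ccontr)
  assume no: "\<not> thesis"
  note found = that
  have "bialt xs ys \<in> lin S (k - 1)" if "set xs \<subseteq> S" "set ys \<subseteq> S" "xs \<noteq> []" "ys \<noteq> []"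
    "length xs + length ys = k" for xs ys using found[OF that] no by blast
  then have "normal_span k \<subseteq> lin S (k - 1)"
    unfolding normal_span_def by (intro span_minimal subspace_lin) auto
  then have top: "w \<in> lin S (k - 1)" if "word S k w" for w
    using word_in_normal_span[OF that assms(2)] by blast
  have "words_upto S k \<subseteq> lin S (k - 1)"
  proof
    fix w assume "w \<in> words_upto S k"
    then obtain j where "j \<le> k" "word S j w" by (auto simp: words_upto_def)
    then show "w \<in> lin S (k - 1)"
      using top word_in_lin[of S j w] lin_monoD[of w S j "k - 1"] by (cases "j = k") auto
  qed
  then have "lin S k \<subseteq> lin S (k - 1)" unfolding lin_def[of S k] by (rule span_minimal[OF _ subspace_lin])
  then show False using assms(1) lin_mono[of "k - 1" k S] by auto
qed

section \<open>Counting the subwords of a nonzero normal form\<close>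

text \<open>Any order of the letters serves, since permuting them changes the words concerned only
  up to sign and lower terms.\<close>

definition enum :: "'a set \<Rightarrow> 'a list" where
  "enum A = (SOME xs. set xs = A \<and> distinct xs)"

lemma enum:
  assumes "finite A"
  shows "set (enum A) = A" "distinct (enum A)" "length (enum A) = card A"
proof -
  have "set (enum A) = A \<and> distinct (enum A)"
    unfolding enum_def using finite_distinct_list[OF assms] by (rule someI_ex)
  then show "set (enum A) = A" "distinct (enum A)" "length (enum A) = card A"
    using distinct_card by fastforce+
qed

lemma enum_append:
  assumes "finite A" "I \<subseteq> A"
  shows "mset (enum (A - I) @ enum I) = mset (enum A)"
proof -
  have f: "finite I" "finite (A - I)" using assms finite_subset by auto
  have "distinct (enum (A - I) @ enum I)" "set (enum (A - I) @ enum I) = set (enum A)"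
    using assms enum[OF f(1)] enum[OF f(2)] enum[OF assms(1)] by auto
  then show ?thesis using enum(2)[OF assms(1)] set_eq_iff_mset_eq_distinct by blast
qed

text \<open>An element of \<open>I'\<close> outside \<open>I\<close> occurs in both lists.\<close>

lemma enum_append_repeat:
  assumes "finite A" "I \<subseteq> A" "I' \<subseteq> A" "\<not> I' \<subseteq> I"
  shows "\<not> distinct (enum (A - I) @ enum I')"
proof -
  have "finite I'" "finite (A - I)" using assms finite_subset by auto
  then show ?thesis using enum(1) assms by auto
qed

text \<open>With a = 2^(p-1) - 1 and b = 2^(q-1) - 1 the right side exceeds 2^(p+q-1) by 2ab + q -
  1, which is positive as \<open>2 \<le> q\<close>.\<close>

lemma count_right:
  assumes "1 \<le> p" "2 \<le> q"
  shows "2 ^ (p + q - 1) + 1 \<le> (2 ^ p - 1) * (2 ^ q - 1) + (q :: nat)"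
proof -
  obtain p' q' where pq: "p = Suc p'" "q = Suc q'" using assms by (metis Suc_le_D One_nat_def numeral_2_eq_2 Suc_le_lessD)
  define a b :: nat where "a = 2 ^ p' - 1" and "b = 2 ^ q' - 1"
  have ab: "(2::nat) ^ p' = a + 1" "(2::nat) ^ q' = b + 1" by (simp_all add: a_def b_def)
  have "(2::nat) ^ (p + q - 1) = 2 * ((a + 1) * (b + 1))"
    using ab by (simp add: pq power_add)
  moreover have "((2::nat) ^ p - 1) * (2 ^ q - 1) = (2 * a + 1) * (2 * b + 1)"
    using ab by (simp add: pq)
  ultimately show ?thesis using assms(2) by (simp add: algebra_simps)
qed

lemma bialt_dim_bound_right:
  assumes fd: finite_dim
    and xs: "set xs \<subseteq> S" "xs \<noteq> []" and ys: "set ys \<subseteq> S" "2 \<le> length ys"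
    and k: "length xs + length ys = k" and nz: "bialt xs ys \<notin> lin S (k - 1)"
  shows "2 ^ (k - 1) + 1 + d0 \<le> dim UNIV"
proof -
  have ysn: "ys \<noteq> []" using ys(2) by auto
  have dist: "distinct xs" "distinct ys"
    using bialt_repeat[OF xs(1) ys(1) xs(2) ysn] nz k by auto
  define X Y where "X = set xs" and "Y = set ys"
  have fin: "finite X" "finite Y" and card: "card X = length xs" "card Y = length ys"
    and XY: "X \<subseteq> S" "Y \<subseteq> S" "X \<noteq> {}" "Y \<noteq> {}"
    using dist distinct_card xs ys ysn by (auto simp: X_def Y_def)
  define K1 where "K1 = (Pow X - {{}}) \<times> (Pow Y - {{}})"
  \<comment> \<open>These pairs index the single letters of \<open>Y\<close>: \<open>bialt\<close>
    of an empty list and a one-letter list is that letter.\<close>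
  define K2 :: "('a set \<times> 'a set) set" where "K2 = {{}} \<times> (\<lambda>y. {y}) ` Y"
  define deg :: "'a set \<times> 'a set \<Rightarrow> nat" where "deg = (\<lambda>(I, J). card I + card J)"
  define v where "v = (\<lambda>(I, J). bialt (enum I) (enum J))"
  define \<phi> where "\<phi> = (\<lambda>(I, J) z. foldr rmult (enum (Y - J)) (foldr mult (enum (X - I)) z))"
  have Kprop: "I \<subseteq> X" "J \<subseteq> Y" "J \<noteq> {}" "finite I" "finite J" "I \<noteq> {} \<or> card J = 1" "card I \<le> card X"
    "card J \<le> card Y" "1 \<le> card J" "set (enum I) \<subseteq> S" "set (enum J) \<subseteq> S" "enum J \<noteq> []"
    "set (enum (X - I)) \<subseteq> S" "set (enum (Y - J)) \<subseteq> S" "card (X - I) = card X - card I"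
    "card (Y - J) = card Y - card J" "enum I \<noteq> [] \<or> length (enum J) = 1"
    if "(I, J) \<in> K1 \<union> K2" for I J
  proof -
    show 1: "I \<subseteq> X" "J \<subseteq> Y" "J \<noteq> {}" "I \<noteq> {} \<or> card J = 1" using that by (auto simp: K1_def K2_def)
    show 2: "finite I" "finite J" using 1 fin finite_subset by auto
    show "card I \<le> card X" "card J \<le> card Y" using 1 fin card_mono by auto
    show "1 \<le> card J" using 1 2 by (simp add: Suc_le_eq card_gt_0_iff)
    show "set (enum I) \<subseteq> S" "set (enum J) \<subseteq> S" "enum J \<noteq> []" using 1 enum(1)[OF 2(1)] enum(1)[OF 2(2)] XY by auto
    show "set (enum (X - I)) \<subseteq> S" "set (enum (Y - J)) \<subseteq> S" using fin XY enum(1) by auto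
    show "card (X - I) = card X - card I" "card (Y - J) = card Y - card J"
      using 1 2 card_Diff_subset by auto
    show "enum I \<noteq> [] \<or> length (enum J) = 1" using 1(4) enum[OF 2(1)] enum[OF 2(2)] by auto
  qed
  \<comment> \<open>A test map turns a subword into a normal form again, so only the presence of
    repeated letters decides its level.\<close>
  have comp: "eq_up_to_sign S (card (X - I) + card (Y - J) + card I' + card J' - 1)
      (\<phi> (I, J) (v (I', J'))) (bialt (enum (X - I) @ enum I') (enum (Y - J) @ enum J'))"
    if "(I, J) \<in> K1 \<union> K2" "(I', J') \<in> K1 \<union> K2" for I J I' J'
    using bialt_extend[OF Kprop(13,14)[OF that(1)] Kprop(10,11,12,17)[OF that(2)]]
      enum(3)[OF Kprop(4)[OF that(2)]] enum(3)[OF Kprop(5)[OF that(2)]] fin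
    by (simp add: \<phi>_def v_def enum(3))
  have "card (K1 \<union> K2) + d0 \<le> dim UNIV"
  proof (rule card_add_d0_le_dim[OF fd, of _ deg k v S \<phi>])
    show "finite (K1 \<union> K2)" using fin by (simp add: K1_def K2_def)
    show "K1 \<union> K2 \<noteq> {}" using XY by (auto simp: K2_def)
  next
    fix i assume "i \<in> K1 \<union> K2"
    then obtain I J where i: "i = (I, J)" and IJ: "(I, J) \<in> K1 \<union> K2" by (cases i) auto
    note p = Kprop[OF IJ]
    show "1 \<le> deg i \<and> deg i \<le> k" using p card k by (simp add: i deg_def)
    show "v i \<in> lin S (deg i)"
      using bialt_lin[OF p(10,11,12)] enum(3)[OF p(4)] enum(3)[OF p(5)] by (simp add: i deg_def v_def)
    show "Vector_Spaces.linear scale scale (\<phi> i)"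
      unfolding i \<phi>_def prod.case
      by (rule linear_comp[OF alt_action_linear_foldr[OF alt_action_rmult]
          alt_action_linear_foldr[OF alt_action_mult]])
    have kd: "k - deg i = card (X - I) + card (Y - J)" using p card k by (simp add: i deg_def)
    show "\<phi> i z \<in> lin S (n + (k - deg i))" if "z \<in> lin S n" for n z
      using foldr_rmult_lin[OF p(14) foldr_mult_lin[OF p(13) that]] fin
      unfolding kd by (simp add: i \<phi>_def enum(3) add_ac)
    have "mset (enum (X - I) @ enum I) = mset xs" "mset (enum (Y - J) @ enum J) = mset ys"
      using enum_append[OF fin(1) p(1)] enum_append[OF fin(2) p(2)] enum(1,2)[OF fin(1)] enum(1,2)[OF fin(2)]
        dist set_eq_iff_mset_eq_distinct unfolding X_def Y_def by metis+
    from bialt_perm[OF xs(1) ys(1) xs(2) ysn this[symmetric]]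
    have "bialt (enum (X - I) @ enum I) (enum (Y - J) @ enum J) \<notin> lin S (k - 1)"
      using nz eq_up_to_sign_mem_iff k by metis
    moreover have "card (X - I) + card (Y - J) + card I + card J - 1 = k - 1" using p card k by simp
    ultimately show "\<phi> i (v i) \<notin> lin S (k - 1)"
      using comp[OF IJ IJ] eq_up_to_sign_mem_iff i by metis
    fix j assume "j \<in> K1 \<union> K2" and ij: "i \<noteq> j" "deg i = deg j"
    then obtain I' J' where j: "j = (I', J')" and IJ': "(I', J') \<in> K1 \<union> K2" by (cases j) auto
    note p' = Kprop[OF IJ']
    \<comment> \<open>Distinct pairs of equal total size cannot be nested, so some letter
      repeats.\<close>
    have "\<not> (I' \<subseteq> I \<and> J' \<subseteq> J)"
    proof
      assume *: "I' \<subseteq> I \<and> J' \<subseteq> J"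
      then have "card I' \<le> card I" "card J' \<le> card J" using card_mono[OF p(4)] card_mono[OF p(5)] by auto
      then have "card I' = card I" "card J' = card J" using ij(2) by (simp_all add: i j deg_def)
      then have "I' = I" "J' = J" using * card_subset_eq[OF p(4)] card_subset_eq[OF p(5)] by auto
      then show False using ij i j by simp
    qed
    then have nd: "\<not> distinct (enum (X - I) @ enum I') \<or> \<not> distinct (enum (Y - J) @ enum J')"
      using enum_append_repeat[OF fin(1) p(1) p'(1)] enum_append_repeat[OF fin(2) p(2) p'(2)] by blast
    \<comment> \<open>\<open>bialt_repeat\<close> needs a nonempty left list. Emptiness would force
      \<open>I = X\<close> and \<open>I' = {}\<close>, so the common degree is 1; as
      \<open>J\<close> already contributes 1, \<open>X\<close> would be empty.\<close>
    have ne: "enum (X - I) @ enum I' \<noteq> []"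
    proof
      assume "enum (X - I) @ enum I' = []"
      then have "X - I = {}" "I' = {}"
        using enum(1)[of "X - I"] enum(1)[OF p'(4)] fin by auto
      then have "I = X" "card I' = 0" "card J' = 1" using p p' by auto
      then have "card X = 0" using ij(2) p(9) by (simp add: i j deg_def)
      then show False using fin XY by simp
    qed
    have len: "length (enum (X - I) @ enum I') = card (X - I) + card I'"
      "length (enum (Y - J) @ enum J') = card (Y - J) + card J'"
      using enum(3) fin p' by auto
    have deg': "card I' + card J' = card I + card J" using ij(2) by (simp add: i j deg_def)
    have "bialt (enum (X - I) @ enum I') (enum (Y - J) @ enum J') \<in>
      lin S (card (X - I) + card I' + (card (Y - J) + card J') - 1)"
      using bialt_repeat[OF _ _ ne _ nd] p p' unfolding len by simp
    moreover have "card (X - I) + card I' + (card (Y - J) + card J') - 1 = k - 1"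
      "card (X - I) + card (Y - J) + card I' + card J' - 1 = k - 1"
      using p card k deg' by simp_all
    ultimately show "\<phi> i (v j) \<in> lin S (k - 1)"
      using comp[OF IJ IJ'] eq_up_to_sign_mem_iff i j by metis
  qed
  moreover have "card (K1 \<union> K2) = (2 ^ length xs - 1) * (2 ^ length ys - 1) + length ys"
  proof -
    have "card K1 = (2 ^ length xs - 1) * (2 ^ length ys - 1)"
      using fin card by (simp add: K1_def card_cartesian_product card_Pow)
    moreover have "card K2 = length ys"
      using card by (simp add: K2_def card_cartesian_product card_image)
    moreover have "K1 \<inter> K2 = {}" by (auto simp: K1_def K2_def)
    ultimately show ?thesis using fin by (subst card_Un_disjoint) (auto simp: K1_def K2_def)
  qed
  moreover have "1 \<le> length xs" using xs(2) by (cases xs) auto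
  ultimately show ?thesis using count_right[of "length xs" "length ys"] ys(2) k by simp
qed

text \<open>With one right letter, the subwords on nonempty subsets of the left letters are
  supplemented by the left letters themselves.\<close>

lemma bialt_dim_bound_left:
  assumes fd: finite_dim
    and xs: "set xs \<subseteq> S" "2 \<le> length xs" and y: "y \<in> S"
    and k: "length xs + 1 = k" and nz: "bialt xs [y] \<notin> lin S (k - 1)"
  shows "2 ^ (k - 1) + 1 + d0 \<le> dim UNIV"
proof -
  let ?L = "\<lambda>as. foldr mult as y"
  have nz': "?L xs \<notin> lin S (length xs)" using nz k by (auto simp: bialt_def)
  have y1: "y \<in> lin S 1" by (rule gen_in_lin[OF y])
  have rep: "?L as \<in> lin S (length as)" if "set as \<subseteq> S" "\<not> distinct as" for as
    using alt_action_repeat[OF alt_action_mult that y1] by simp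
  have dist: "distinct xs" using rep[OF xs(1)] nz' by auto
  define X where "X = set xs"
  have fin: "finite X" and card: "card X = length xs" and XS: "X \<subseteq> S"
    using dist distinct_card xs by (auto simp: X_def)
  have full: "?L as \<notin> lin S (length xs)" if "mset as = mset (enum X)" for as
  proof -
    have "mset xs = mset as"
      using that enum(1,2)[OF fin] dist set_eq_iff_mset_eq_distinct unfolding X_def by metis
    from alt_action_perm[OF alt_action_mult xs(1) this y1] show ?thesis
      using nz' eq_up_to_sign_mem_iff by auto
  qed
  define K :: "('a set + 'a) set" where "K = Inl ` (Pow X - {{}}) \<union> Inr ` X"
  define deg :: "'a set + 'a \<Rightarrow> nat" where "deg = case_sum (\<lambda>I. Suc (card I)) (\<lambda>x. 1)"
  define v where "v = case_sum (\<lambda>I. ?L (enum I)) (\<lambda>x. x)"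
  \<comment> \<open>The test map of a letter \<open>x\<close> first multiplies by \<open>y\<close>
    on the right, giving \<open>mult x y\<close>, and then restores the other letters on the
    left.\<close>
  define \<phi> where "\<phi> = case_sum (\<lambda>I z. foldr mult (enum (X - I)) z)
    (\<lambda>x z. foldr mult (enum (X - {x})) (mult z y))"
  have enumS: "set (enum I) \<subseteq> S" "length (enum I) = card I" if "I \<subseteq> X" for I
    using that enum[OF finite_subset[OF that fin]] XS by auto
  have pos: "1 \<le> card I" "card I \<le> card X" "card (X - I) = card X - card I" if "I \<subseteq> X" "I \<noteq> {}" for I
    using that fin card_mono[OF fin that(1)] card_Diff_subset[of I X] finite_subset[OF that(1) fin]
    by (auto simp: Suc_le_eq card_gt_0_iff)
  have "card K + d0 \<le> dim UNIV"
  proof (rule card_add_d0_le_dim[OF fd, of _ deg k v S \<phi>])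
    show "finite K" using fin by (simp add: K_def)
    show "K \<noteq> {}" using xs card by (auto simp: K_def)
  next
    fix i assume "i \<in> K"
    then consider I where "i = Inl I" "I \<subseteq> X" "I \<noteq> {}" | x where "i = Inr x" "x \<in> X"
      by (auto simp: K_def)
    note cs = this
    show "1 \<le> deg i \<and> deg i \<le> k"
      by (cases rule: cs) (use pos card k in \<open>auto simp: deg_def\<close>)
    show "v i \<in> lin S (deg i)"
    proof (cases rule: cs)
      case 1
      then show ?thesis using foldr_mult_lin[OF enumS(1) y1, of I] enumS(2)[of I] by (simp add: deg_def v_def)
    next
      case 2
      then show ?thesis using gen_in_lin[of x S] XS by (auto simp: deg_def v_def)
    qed
    show "Vector_Spaces.linear scale scale (\<phi> i)"
      using alt_action_linear_foldr[OF alt_action_mult]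
        linear_comp[OF alt_action_linear_foldr[OF alt_action_mult] linear_mult_left]
      by (cases rule: cs) (auto simp: \<phi>_def)
    show "\<phi> i z \<in> lin S (n + (k - deg i))" if z: "z \<in> lin S n" for n z
    proof (cases rule: cs)
      case 1
      then show ?thesis
        using foldr_mult_lin[OF enumS(1) z, of "X - I"] enumS(2)[of "X - I"] pos[of I] card k
        by (auto simp: \<phi>_def deg_def add_ac)
    next
      case 2
      have "card (X - {x}) + (n + 1) = n + (k - deg i)"
        using 2 fin card k xs(2) by (simp add: card_Diff_singleton deg_def)
      moreover have "\<phi> i z \<in> lin S (card (X - {x}) + (n + 1))"
        using 2 foldr_mult_lin[OF enumS(1) lin_mult[OF z y1], of "X - {x}"] enumS(2)[of "X - {x}"]
        by (simp add: \<phi>_def)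
      ultimately show ?thesis by (simp only:)
    qed
    show "\<phi> i (v i) \<notin> lin S (k - 1)"
    proof (cases rule: cs)
      case 1
      then show ?thesis using full[OF enum_append[OF fin 1(2)]] k by (auto simp: \<phi>_def v_def)
    next
      case 2
      have "enum {x} = [x]" using enum[of "{x}"] by (cases "enum {x}") auto
      then show ?thesis using 2 full[OF enum_append[OF fin, of "{x}"]] k
        by (auto simp: \<phi>_def v_def)
    qed
    fix j assume "j \<in> K" and ij: "i \<noteq> j" "deg i = deg j"
    then consider I where "j = Inl I" "I \<subseteq> X" "I \<noteq> {}" | x where "j = Inr x" "x \<in> X"
      by (auto simp: K_def)
    note cs' = this
    show "\<phi> i (v j) \<in> lin S (k - 1)"
    proof (cases rule: cs)
      case I: (1 I)
      show ?thesis
      proof (cases rule: cs')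
        case J: (1 J)
        have c: "card J = card I" using ij by (simp add: I J deg_def)
        have "\<not> J \<subseteq> I" using c ij I J card_subset_eq finite_subset[OF _ fin] by blast
        then have "\<not> distinct (enum (X - I) @ enum J)" using enum_append_repeat[OF fin] I J by blast
        from rep[OF _ this] show ?thesis
          using I J c enumS[of "X - I"] enumS[of J] pos[of I] card
          by (simp add: \<phi>_def v_def k[symmetric])
      next
        \<comment> \<open>Letters have degree 1 and the other subwords degree at least 2, so the
          mixed cases cannot occur.\<close>
        case J: (2 x)
        then show ?thesis using ij(2) I pos(1)[of I] by (simp add: deg_def)
      qed
    next
      case I: (2 x)
      show ?thesis
      proof (cases rule: cs')
        case J: (1 J)
        then show ?thesis using ij(2) I pos(1)[of J] by (simp add: deg_def)
      next
        case J: (2 x')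
        have nd: "\<not> distinct (enum (X - {x}) @ [x'])" using I J ij(1) enum(1)[of "X - {x}"] fin by auto
        have "Suc (length xs - Suc 0) = length xs" using xs(2) by simp
        with rep[OF _ nd] show ?thesis
          using I J enumS[of "X - {x}"] XS card fin xs(2)
          by (simp add: \<phi>_def v_def card_Diff_singleton subset_iff k[symmetric])
      qed
    qed
  qed
  moreover have "card K = (2 ^ length xs - 1) + length xs"
  proof -
    have "card (Inl ` (Pow X - {{}}) :: ('a set + 'a) set) = 2 ^ length xs - 1"
      using fin card by (simp add: card_image card_Pow)
    moreover have "card (Inr ` X :: ('a set + 'a) set) = length xs"
      using card by (simp add: card_image)
    ultimately show ?thesis using fin unfolding K_def by (subst card_Un_disjoint) auto
  qed
  \<comment> \<open>Here \<open>k - 1 = length xs\<close>, and \<open>2 \<le> length xs\<close>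
    lifts the count to at least \<open>2 ^ (k - 1) + 1\<close>.\<close>
  moreover have "(1::nat) \<le> 2 ^ length xs" by simp
  ultimately show ?thesis using xs(2) k[symmetric] by simp
qed

lemma dim_bound:
  assumes "finite_dim" "lin S k \<noteq> lin S (k - 1)" "3 \<le> k"
  shows "2 ^ (k - 1) + 1 + d0 \<le> dim UNIV"
proof -
  obtain xs ys where xy: "set xs \<subseteq> S" "set ys \<subseteq> S" "xs \<noteq> []" "ys \<noteq> []"
    "length xs + length ys = k" "bialt xs ys \<notin> lin S (k - 1)"
    using exists_nonzero_bialt[OF assms(2)] assms(3) by auto
  show ?thesis
  proof (cases "2 \<le> length ys")
    case True
    then show ?thesis using bialt_dim_bound_right[OF assms(1)] xy by blast
  next
    case False
    \<comment> \<open>With a single right letter, \<open>3 \<le> k\<close> leaves at least two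
      letters in \<open>xs\<close>.\<close>
    then obtain y where "ys = [y]" using xy(4) by (cases ys rule: remdups_adj.cases) auto
    then show ?thesis using bialt_dim_bound_left[OF assms(1), of xs y] xy assms(3) by auto
  qed
qed

end

section \<open>From strict steps of the filtration to the length\<close>

text \<open>Each vector of a finite spanning set appears at some level, and the largest of these
  levels is everything. Thus the \<open>LEAST\<close> in \<open>set_length\<close> is
  attained.\<close>

lemma generating_lin_eq:
  assumes "finite_dim" "generating S"
  shows "\<exists>k. lin S k = lin_inf S"
proof -
  obtain B where B: "finite B" "span B = UNIV" using assms(1) by (auto simp: finite_dim_def)
  have "\<forall>b. \<exists>k. b \<in> lin S k" using assms(2) by (auto simp: generating_def lin_inf_def)
  then obtain m where m: "\<And>b. b \<in> lin S (m b)" by metis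
  have "B \<subseteq> lin S (Max (m ` B))" using lin_monoD[OF m] B(1) by auto
  then have "span B \<subseteq> lin S (Max (m ` B))" by (rule span_minimal[OF _ subspace_lin])
  then show ?thesis using B(2) assms(2) by (auto simp: generating_def)
qed

lemma set_length_bound:
  assumes "finite_dim" "generating S" "descendingly_alternative" "3 \<le> set_length S"
  shows "2 ^ (set_length S - 1) + 1 + d0 \<le> dim UNIV"
proof -
  have "lin S (set_length S) = lin_inf S"
    unfolding set_length_def using generating_lin_eq[OF assms(1,2)] by (rule LeastI_ex)
  \<comment> \<open>Minimality of the length makes the last step of the filtration strict, as
    \<open>dim_bound\<close> requires.\<close>
  moreover have "lin S (set_length S - 1) \<noteq> lin_inf S"
    using not_less_Least[of "set_length S - 1" "\<lambda>k. lin S k = lin_inf S"] assms(4)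
    by (simp add: set_length_def)
  ultimately show ?thesis using dim_bound[OF assms(3,1) _ assms(4), of S] by simp
qed

lemma generating_UNIV: "generating UNIV"
  using gen_in_lin by (auto simp: generating_def lin_inf_def)

text \<open>\<open>Max\<close> is meaningful only on a finite nonempty set: the bound itself gives
  finiteness, and \<open>UNIV\<close> is a generating set.\<close>

lemma alg_length_le:
  assumes "\<And>S. generating S \<Longrightarrow> set_length S \<le> n"
  shows "alg_length \<le> n"
proof -
  have "{set_length S | S. generating S} \<subseteq> {..n}" using assms by auto
  moreover from this have "finite {set_length S | S. generating S}" by (rule finite_subset) simp
  ultimately show ?thesis unfolding alg_length_def using generating_UNIV
    by (subst Max_le_iff) auto
qed

end

theorem corollary4p6:
  fixes scale :: "'f::field \<Rightarrow> 'a::ab_group_add \<Rightarrow> 'a"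
    and mult :: "'a \<Rightarrow> 'a \<Rightarrow> 'a"
  assumes "nonassoc_algebra scale mult"
    and "nonassoc_algebra.finite_dim scale"
    and "nonassoc_algebra.descendingly_alternative scale mult"
    and "int (vector_space.dim scale UNIV) - int (nonassoc_algebra.d0 mult) \<ge> 3"
  shows "int (nonassoc_algebra.alg_length scale mult)
    \<le> \<lceil>log 2 (real (vector_space.dim scale UNIV) - real (nonassoc_algebra.d0 mult))\<rceil>"
proof -
  interpret nonassoc_algebra scale mult by (rule assms(1))
  define N where "N = real (dim UNIV) - real d0"
  have N: "3 \<le> N" using assms(4) by (simp add: N_def)
  have le: "int m \<le> \<lceil>log 2 N\<rceil>" if "2 ^ (m - 1) < N" "1 \<le> m" for m
  proof -
    have "real (m - 1) < log 2 N" using that(1) by (rule less_log_of_power) simp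
    then show ?thesis using that(2) by (simp add: less_ceiling_iff le_ceiling_iff of_nat_diff)
  qed
  \<comment> \<open>This covers generating sets of length at most 2, since 2 < 3 \<le> N.\<close>
  have two: "int 2 \<le> \<lceil>log 2 N\<rceil>" by (rule le) (use N in simp_all)
  have "set_length S \<le> nat \<lceil>log 2 N\<rceil>" if "generating S" for S
  proof (cases "3 \<le> set_length S")
    case True
    \<comment> \<open>The summand 1 gives the strict inequality that \<open>le\<close> needs;
      equality at a power of two would lose one in the ceiling.\<close>
    have "(2::real) ^ (set_length S - 1) + 1 + real d0 \<le> real (dim UNIV)"
      using of_nat_mono[OF set_length_bound[OF assms(2) that assms(3) True], where 'a = real] by simp
    then show ?thesis using le[of "set_length S"] True by (simp add: N_def)
  next
    case False
    then show ?thesis using two by linarith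
  qed
  then have "alg_length \<le> nat \<lceil>log 2 N\<rceil>" by (rule alg_length_le)
  then show ?thesis using two unfolding N_def by linarith
qed

end
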